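(* Let $X$ be a separable Banach space with basis $\{e_k\}_{k=1}^\infty$ and associated dual basis $\{e_k^*\}_{k=1}^\infty$, and let $X_d$ be a solid Banach sequence space with an absolutely continuous norm, which contains the canonical unit vectors $\{\delta_k\}_{k=1}^\infty$. Let $\{f_k\}_{k=1}^\infty\subset X$ and assume the following: (i) The left/right-shift operators $L,R$ with respect to the basis $\{e_k\}_{k=1}^\infty$ are bounded on $X$. Choose any $\lambda>\|R\|$ and put $T:=\lambda L$, $S:=\lambda^{-1}R$. (ii) There exists a constant $B>0$ such that $\left\|\sum_{k=1}^\infty c_ke_k\right\|\le B\,\|\{c_k\}_{k=1}^\infty\|_{X_d}$ for all finite sequences $\{c_k\}_{k=1}^\infty$. (iii) There exist constants $C>0$ and $\beta>\ln\lambda$ such that $\{e^{-\beta j}\}_{j=1}^\infty\in X_d$ and $$|\langle f_k,e_j^*\rangle|\le C e^{-\beta|j-k|},\qquad \forall j,k\in\mathbb N.$$ Fix a sequence $\{\epsilon_k\}_{k=1}^\infty\in\ell^1$ of positive scalars and choose a strictly increasing sequence of nonnegative integers $\{\alpha(k)\}_{k=1}^\infty$ such that for all $k\ge2$, $$\|S\|^{\alpha(k)-\alpha(k-1)}\,\|f_k\|_X\le \epsilon_k/2. \qquad ( * )$$ Then $\varphi:=\sum_{k=1}^\infty S^{\alpha(k)}f_k$ is well-defined (the series converges in $X$). Moreover, if $\{\alpha(k)\}_{k=1}^\infty$ (satisfying $( * )$) is chosen with $\alpha(1)=0$ and recursively such that, for all $k\ge2$, $$\alpha(k)\ge\alpha(k-1)+k-2$$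 and $$\alpha(k)>\frac{\ln\Big(\sum_{j=k+1}^\infty\epsilon_j\Big)-\ln\Big(\big\|\{e^{-\beta j}\}_{j=1}^\infty\big\|_{X_d}\Big)-\ln\Big(\sum_{n=1}^{k-1}(\lambda e^{-\beta})^{-\alpha(n)}e^{\beta n}\Big)-\ln(2BC)}{\ln(\lambda)-\beta},$$ then $$\|f_k-T^{\alpha(k)}\varphi\|_X\le\sum_{n=k+1}^\infty\epsilon_n,\qquad\forall k\in\mathbb N.$$
   Context: A sequence $\{e_k\}_{k=1}^\infty$ in a Banach space $X$ is a (Schauder) basis if every $x\in X$ has a unique representation $x=\sum_{k=1}^\infty c_ke_k$, $c_k\in\mathbb C$; the dual basis $\{e_k^*\}_{k=1}^\infty\subset X^*$ consists of the coefficient functionals, so $x=\sum_{k=1}^\infty\langle x,e_k^*\rangle e_k$, where $\langle x,e_k^*\rangle$ is the value of $e_k^*$ at $x$. The left-shift and right-shift operators are the linear maps $L,R:\mathrm{span}\{e_k\}\to X$ given by $Le_1=0$, $Le_k=e_{k-1}$ ($k\ge2$), $Re_k=e_{k+1}$ ($k\in\mathbb N$); "bounded on $X$" means that they extend to bounded linear operators on $X$, denoted by the same letters. A Banach sequence space $X_d$ is a Banach space consisting of scalar-valued sequences indexed by $\mathbb N$. It is solid if whenever $\{c_k\}_{k=1}^\infty\in X_d$ and $\{b_k\}_{k=1}^\infty$ is a scalar sequence with $|b_k|\le|c_k|$ for all $k$, then $\{b_k\}_{k=1}^\infty\in X_d$ and $\|\{b_k\}\|_{X_d}\le\|\{c_k\}\|_{X_d}$.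 It has an absolutely continuous norm if $\|\{c_k-c_k\chi_{I_n}(k)\}_{k=1}^\infty\|_{X_d}\to0$ as $n\to\infty$ for every $\{c_k\}_{k=1}^\infty\in X_d$ and every family of subsets $I_n\subset\mathbb N$ with $I_1\subset I_2\subset\cdots$ and $\bigcup_nI_n=\mathbb N$. The canonical unit vector $\delta_k$ is the sequence with $1$ in position $k$ and $0$ elsewhere. A finite sequence is one with only finitely many nonzero entries. *)

theory Defs
  imports "HOL-Analysis.Analysis"
begin

text \<open>
  Sequences are indexed by the positive integers. A family in a Banach space (\<open>e\<close>, \<open>f\<close>) is a
  function on \<^typ>\<open>nat\<close> whose value at \<open>0\<close> is never used. A scalar sequence regarded as a vector
  (a coefficient sequence, an element of a sequence space) has value \<open>0\<close> at index \<open>0\<close>, so that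
  equality of functions is equality of sequences.
\<close>

class complex_banach = banach +
  fixes scaleC :: "complex \<Rightarrow> 'a \<Rightarrow> 'a"  (infixr \<open>*\<^sub>C\<close> 75)
  assumes scaleC_add_right: "a *\<^sub>C (x + y) = a *\<^sub>C x + a *\<^sub>C y"
    and scaleC_add_left: "(a + b) *\<^sub>C x = a *\<^sub>C x + b *\<^sub>C x"
    and scaleC_scaleC: "a *\<^sub>C b *\<^sub>C x = (a * b) *\<^sub>C x"
    and scaleC_of_real: "complex_of_real r *\<^sub>C x = r *\<^sub>R x"
    and norm_scaleC: "norm (a *\<^sub>C x) = cmod a * norm x"

definition bounded_clinear :: "('a::complex_banach \<Rightarrow> 'b::complex_banach) \<Rightarrow> bool" where
  "bounded_clinear A \<longleftrightarrow> bounded_linear A \<and> (\<forall>a x. A (a *\<^sub>C x) = a *\<^sub>C A x)"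

definition expansion :: "(nat \<Rightarrow> 'a::complex_banach) \<Rightarrow> 'a \<Rightarrow> (nat \<Rightarrow> complex) \<Rightarrow> bool" where
  "expansion e x c \<longleftrightarrow> c 0 = 0 \<and> (\<lambda>k. c (Suc k) *\<^sub>C e (Suc k)) sums x"

definition schauder_basis :: "(nat \<Rightarrow> 'a::complex_banach) \<Rightarrow> bool" where
  "schauder_basis e \<longleftrightarrow> (\<forall>x. \<exists>!c. expansion e x c)"

text \<open>The coefficient functionals; meaningful when \<open>e\<close> is a Schauder basis.\<close>

definition dual_basis :: "(nat \<Rightarrow> 'a::complex_banach) \<Rightarrow> nat \<Rightarrow> 'a \<Rightarrow> complex" where
  "dual_basis e k x = (THE c. expansion e x c) k"

text \<open>
  For a basis \<open>e\<close>, a bounded operator on the whole space is determined by its values on the basis;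
  so these predicates say that the shift on the linear span extends boundedly and that the given
  operator is this unique extension.
\<close>

definition left_shift :: "(nat \<Rightarrow> 'a::complex_banach) \<Rightarrow> ('a \<Rightarrow> 'a) \<Rightarrow> bool" where
  "left_shift e L \<longleftrightarrow> bounded_clinear L \<and> L (e 1) = 0 \<and> (\<forall>k\<ge>2. L (e k) = e (k - 1))"

definition right_shift :: "(nat \<Rightarrow> 'a::complex_banach) \<Rightarrow> ('a \<Rightarrow> 'a) \<Rightarrow> bool" where
  "right_shift e R \<longleftrightarrow> bounded_clinear R \<and> (\<forall>k\<ge>1. R (e k) = e (k + 1))"

text \<open>
  The set \<open>Xd\<close> is the carrier of the sequence space and \<open>nrm\<close> its norm; the values of \<open>nrm\<close>
  outside \<open>Xd\<close> are unconstrained. Nonnegativity of the norm on \<open>Xd\<close> follows from the axioms.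
\<close>

locale banach_sequence_space =
  fixes Xd :: "(nat \<Rightarrow> complex) set" and nrm :: "(nat \<Rightarrow> complex) \<Rightarrow> real"
  assumes index_0: "c \<in> Xd \<Longrightarrow> c 0 = 0"
    and zero_mem: "(\<lambda>_. 0) \<in> Xd"
    and add_mem: "c \<in> Xd \<Longrightarrow> d \<in> Xd \<Longrightarrow> (\<lambda>k. c k + d k) \<in> Xd"
    and scale_mem: "c \<in> Xd \<Longrightarrow> (\<lambda>k. a * c k) \<in> Xd"
    and nrm_eq_0_iff: "c \<in> Xd \<Longrightarrow> nrm c = 0 \<longleftrightarrow> c = (\<lambda>_. 0)"
    and nrm_scale: "c \<in> Xd \<Longrightarrow> nrm (\<lambda>k. a * c k) = cmod a * nrm c"
    and nrm_triangle: "c \<in> Xd \<Longrightarrow> d \<in> Xd \<Longrightarrow> nrm (\<lambda>k. c k + d k) \<le> nrm c + nrm d"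
    and complete: "(\<And>n. u n \<in> Xd) \<Longrightarrow>
      (\<And>r. r > 0 \<Longrightarrow> \<exists>N. \<forall>m\<ge>N. \<forall>n\<ge>N. nrm (\<lambda>k. u m k - u n k) < r) \<Longrightarrow>
      \<exists>c\<in>Xd. (\<lambda>n::nat. nrm (\<lambda>k. u n k - c k)) \<longlonglongrightarrow> 0"

definition solid :: "(nat \<Rightarrow> complex) set \<Rightarrow> ((nat \<Rightarrow> complex) \<Rightarrow> real) \<Rightarrow> bool" where
  "solid Xd nrm \<longleftrightarrow>
    (\<forall>c\<in>Xd. \<forall>b. (\<forall>k. cmod (b k) \<le> cmod (c k)) \<longrightarrow> b \<in> Xd \<and> nrm b \<le> nrm c)"

definition absolutely_continuous_norm ::
    "(nat \<Rightarrow> complex) set \<Rightarrow> ((nat \<Rightarrow> complex) \<Rightarrow> real) \<Rightarrow> bool" where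
  "absolutely_continuous_norm Xd nrm \<longleftrightarrow>
    (\<forall>c\<in>Xd. \<forall>I :: nat \<Rightarrow> nat set. incseq I \<and> (\<Union>n. I n) = {1..} \<longrightarrow>
      (\<lambda>n. nrm (\<lambda>k. c k - c k * indicator (I n) k)) \<longlonglongrightarrow> 0)"

definition unit_seq :: "nat \<Rightarrow> nat \<Rightarrow> complex" where
  "unit_seq k = (\<lambda>j. if j = k then 1 else 0)"

definition exp_seq :: "real \<Rightarrow> nat \<Rightarrow> complex" where
  "exp_seq \<beta> = (\<lambda>j. if j = 0 then 0 else complex_of_real (exp (- \<beta> * real j)))"

definition finite_seq :: "(nat \<Rightarrow> complex) \<Rightarrow> bool" where
  "finite_seq c \<longleftrightarrow> c 0 = 0 \<and> finite {k. c k \<noteq> 0}"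

end

theory Submission
  imports Defs
begin

text \<open>
  Since \<open>T S = I\<close>, the error \<open>f k - T ^ \<alpha> k \<phi>\<close> splits into the terms \<open>T ^ (\<alpha> k - \<alpha> n) (f n)\<close>
  with \<open>n < k\<close> and the terms \<open>S ^ (\<alpha> n - \<alpha> k) (f n)\<close> with \<open>n > k\<close>. Since \<open>\<parallel>S\<parallel> < 1\<close>, the norm bound on
  the \<open>f n\<close> makes the latter contribute at most half of the tail of \<open>\<epsilon>\<close>. For the former, the gap condition
  \<open>\<alpha> k - \<alpha> n \<ge> n - 1\<close> pushes the peak of the coefficients of \<open>f n\<close> out of range: after the
  left shift they are dominated by a multiple of \<open>exp_seq \<beta>\<close>, and the lower bound on \<open>\<alpha> k\<close> says exactly
  that these norms add up to less than the other half.
\<close>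

section \<open>Iterates of an operator with a right inverse, and their norms\<close>

lemma funpow_left_inverse:
  fixes T S :: "'a \<Rightarrow> 'a"
  assumes "\<And>x. T (S x) = x"
  shows "(T ^^ a) ((S ^^ a) x) = x"
proof (induction a)
  case (Suc a)
  have "(T ^^ Suc a) ((S ^^ Suc a) x) = (T ^^ a) (T (S ((S ^^ a) x)))"
    by (simp add: funpow_swap1)
  then show ?case using assms Suc by simp
qed simp

lemma funpow_left_inverse_le:
  fixes T S :: "'a \<Rightarrow> 'a"
  assumes "\<And>x. T (S x) = x" and "b \<le> a"
  shows "(T ^^ a) ((S ^^ b) x) = (T ^^ (a - b)) x"
proof -
  have "(T ^^ a) ((S ^^ b) x) = (T ^^ (a - b)) ((T ^^ b) ((S ^^ b) x))"
    using assms(2) by (metis comp_apply funpow_add le_add_diff_inverse2)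
  then show ?thesis by (simp add: funpow_left_inverse[of T S, OF assms(1)])
qed

lemma funpow_left_inverse_ge:
  fixes T S :: "'a \<Rightarrow> 'a"
  assumes "\<And>x. T (S x) = x" and "a \<le> b"
  shows "(T ^^ a) ((S ^^ b) x) = (S ^^ (b - a)) x"
proof -
  have "(T ^^ a) ((S ^^ b) x) = (T ^^ a) ((S ^^ a) ((S ^^ (b - a)) x))"
    using assms(2) by (metis comp_apply funpow_add le_add_diff_inverse)
  then show ?thesis by (simp add: funpow_left_inverse[of T S, OF assms(1)])
qed

lemma bounded_linear_funpow:
  fixes A :: "'a::real_normed_vector \<Rightarrow> 'a"
  assumes "bounded_linear A"
  shows "bounded_linear (A ^^ n)"
proof (induction n)
  case 0
  then show ?case using bounded_linear_ident by (simp add: id_def)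
next
  case (Suc n)
  then show ?case using bounded_linear_compose[OF assms Suc] by (simp add: comp_def)
qed

lemma norm_funpow_le:
  fixes A :: "'a::real_normed_vector \<Rightarrow> 'a"
  assumes "bounded_linear A"
  shows "norm ((A ^^ n) x) \<le> onorm A ^ n * norm x"
proof (induction n)
  case (Suc n)
  have "norm ((A ^^ Suc n) x) \<le> onorm A * norm ((A ^^ n) x)"
    using onorm[OF assms] by simp
  also have "\<dots> \<le> onorm A * (onorm A ^ n * norm x)"
    by (intro mult_left_mono Suc onorm_pos_le assms)
  finally show ?case by (simp add: mult.assoc)
qed simp

lemma funpow_scaleR:
  fixes A :: "'a::real_normed_vector \<Rightarrow> 'a"
  assumes "bounded_linear A"
  shows "((\<lambda>x. r *\<^sub>R A x) ^^ n) x = r ^ n *\<^sub>R (A ^^ n) x"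
  by (induction n) (simp_all add: linear_cmul bounded_linear.linear[OF assms])

section \<open>Basis expansions under bounded operators and shifts\<close>

lemma scaleC_zero_left [simp]: "0 *\<^sub>C x = 0"
  using norm_scaleC[of 0 x] by simp

lemma scaleC_zero_right [simp]: "a *\<^sub>C (0 :: 'a::complex_banach) = 0"
  using norm_scaleC[of a "0::'a"] by simp

lemma bounded_clinear_linear: "bounded_clinear A \<Longrightarrow> bounded_linear A"
  by (simp add: bounded_clinear_def)

lemma bounded_clinear_sums:
  assumes "bounded_clinear A" "expansion e x c"
  shows "(\<lambda>k. c (Suc k) *\<^sub>C A (e (Suc k))) sums A x"
  using bounded_linear.sums[of A "\<lambda>k. c (Suc k) *\<^sub>C e (Suc k)" x] assms
  by (simp add: bounded_clinear_def expansion_def)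

lemma expansion_dual_basis:
  assumes "schauder_basis e"
  shows "expansion e x (\<lambda>j. dual_basis e j x)"
  unfolding dual_basis_def using theI'[of "expansion e x"] assms
  by (simp add: schauder_basis_def)

text \<open>Continuity lets \<open>L\<close> act termwise; the first term dies because
  \<open>L (e 1) = 0\<close>, and reindexing the rest moves every coefficient down by one. Index 0
  must be reset to 0, since \<open>expansion\<close> demands it and \<open>c 1\<close> would land
  there.\<close>

lemma expansion_left_shift:
  assumes "left_shift e L" "expansion e x c"
  shows "expansion e (L x) (\<lambda>j. if j = 0 then 0 else c (Suc j))"
proof -
  have "(\<lambda>k. c (Suc k) *\<^sub>C L (e (Suc k))) sums L x"
    using assms by (intro bounded_clinear_sums) (simp_all add: left_shift_def)
  then have "(\<lambda>k. c (Suc (Suc k)) *\<^sub>C L (e (Suc (Suc k)))) sums (L x - c 1 *\<^sub>C L (e 1))"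
    using sums_Suc_iff[of "\<lambda>k. c (Suc k) *\<^sub>C L (e (Suc k))"] by simp
  then show ?thesis
    using assms(1) by (simp add: left_shift_def expansion_def)
qed

lemma expansion_left_shift_funpow:
  assumes "left_shift e L" "expansion e x c"
  shows "expansion e ((L ^^ m) x) (\<lambda>j. if j = 0 then 0 else c (j + m))"
proof (induction m)
  case 0
  have "(\<lambda>j. if j = 0 then 0 else c (j + 0)) = c"
    using assms(2) by (auto simp: expansion_def)
  then show ?case using assms(2) by (simp del: add_0_right)
next
  case (Suc m)
  show ?case
    using expansion_left_shift[OF assms(1) Suc] by (simp cong: if_cong)
qed

text \<open>The composite fixes every basis vector, so by continuity it maps the expansion of
  \<open>x\<close> to itself; limits are unique.\<close>

lemma left_shift_right_shift:
  assumes "schauder_basis e" "left_shift e L" "right_shift e R"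
  shows "L (R x) = x"
proof -
  obtain c where c: "expansion e x c"
    using assms(1) expansion_dual_basis by blast
  have "bounded_clinear (\<lambda>x. L (R x))"
    using assms(2,3) bounded_linear_compose[of L R]
    by (simp add: left_shift_def right_shift_def bounded_clinear_def)
  from bounded_clinear_sums[OF this c]
  have "(\<lambda>k. c (Suc k) *\<^sub>C e (Suc k)) sums L (R x)"
    using assms(2,3) by (simp add: left_shift_def right_shift_def)
  then show ?thesis
    using c sums_unique2 by (auto simp: expansion_def)
qed

section \<open>From coefficient bounds in the sequence space to norm bounds\<close>

context banach_sequence_space
begin

text \<open>The triangle inequality for \<open>c + (-c) = 0\<close> gives
  \<open>0 \<le> 2 * nrm c\<close>.\<close>

lemma nrm_nonneg:
  assumes "c \<in> Xd"
  shows "0 \<le> nrm c"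
proof -
  have "nrm (\<lambda>k. c k + (- 1) * c k) \<le> nrm c + nrm (\<lambda>k. (- 1) * c k)"
    using assms by (intro nrm_triangle scale_mem)
  moreover have "nrm (\<lambda>k. (- 1) * c k) = nrm c"
    using nrm_scale[OF assms, of "- 1"] by simp
  moreover have "nrm (\<lambda>_. 0) = 0"
    using nrm_eq_0_iff[OF zero_mem] by simp
  ultimately show ?thesis by simp
qed

text \<open>This carries the bound from finite sequences to all of \<open>Xd\<close>: by solidity
  the truncations of \<open>c\<close> have norm at most \<open>nrm c\<close>, so every partial sum
  obeys the bound, and it survives in the limit.\<close>

lemma norm_expansion_le:
  fixes e :: "nat \<Rightarrow> 'a::complex_banach"
  assumes solid: "solid Xd nrm"
    and fin: "\<forall>c. finite_seq c \<longrightarrow> norm (\<Sum>k | c k \<noteq> 0. c k *\<^sub>C e k) \<le> B * nrm c"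
    and "B > 0" and c: "c \<in> Xd" and x: "expansion e x c"
  shows "norm x \<le> B * nrm c"
proof -
  have partial: "norm (\<Sum>k<N. c (Suc k) *\<^sub>C e (Suc k)) \<le> B * nrm c" for N
  proof -
    define d where "d = (\<lambda>k. if k \<le> N then c k else 0)"
    have sub: "{k. d k \<noteq> 0} \<subseteq> {1..N}"
      using index_0[OF c] by (auto simp: d_def Suc_le_eq split: if_splits intro: gr0I)
    have "nrm d \<le> nrm c"
      using solid c by (simp add: solid_def d_def)
    have "finite_seq d"
      using finite_subset[OF sub] index_0[OF c] by (simp add: finite_seq_def d_def)
    moreover have "(\<Sum>k | d k \<noteq> 0. d k *\<^sub>C e k) = (\<Sum>k=1..N. d k *\<^sub>C e k)"
      using sub by (intro sum.mono_neutral_left) auto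
    moreover have "\<dots> = (\<Sum>k<N. c (Suc k) *\<^sub>C e (Suc k))"
      by (rule sum.reindex_bij_witness[of _ Suc "\<lambda>k. k - 1"]) (auto simp: d_def)
    ultimately have "norm (\<Sum>k<N. c (Suc k) *\<^sub>C e (Suc k)) \<le> B * nrm d"
      using fin by metis
    also have "\<dots> \<le> B * nrm c"
      using \<open>nrm d \<le> nrm c\<close> \<open>B > 0\<close> by simp
    finally show ?thesis .
  qed
  have "(\<lambda>N. norm (\<Sum>k<N. c (Suc k) *\<^sub>C e (Suc k))) \<longlonglongrightarrow> norm x"
    using x by (intro tendsto_norm) (simp add: expansion_def sums_def)
  then show ?thesis
    by (rule LIMSEQ_le_const2) (use partial in blast)
qed

text \<open>After \<open>m\<close> shifts, coefficient \<open>j\<close> is \<open>c (j + m)\<close>.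
  Since \<open>j \<ge> 1\<close> and \<open>n \<le> m + 1\<close>, the index \<open>j + m\<close> is
  at least \<open>n\<close>, so the absolute value opens and the decay factors as a constant
  \<open>r\<close> times \<open>exp_seq \<beta> j\<close>. Solidity then bounds the norm of the
  shifted sequence.\<close>

lemma norm_left_shift_funpow_le:
  fixes e :: "nat \<Rightarrow> 'a::complex_banach"
  assumes solid: "solid Xd nrm"
    and fin: "\<forall>c. finite_seq c \<longrightarrow> norm (\<Sum>k | c k \<noteq> 0. c k *\<^sub>C e k) \<le> B * nrm c"
    and "B > 0" "C > 0" and exp_mem: "exp_seq \<beta> \<in> Xd"
    and L: "left_shift e L" and x: "expansion e x c"
    and decay: "\<forall>j\<ge>1. cmod (c j) \<le> C * exp (- \<beta> * \<bar>real j - real n\<bar>)"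
    and n: "n \<le> m + 1"
  shows "norm ((L ^^ m) x) \<le> B * C * exp (- \<beta> * (real m - real n)) * nrm (exp_seq \<beta>)"
proof -
  define r where "r = C * exp (- \<beta> * (real m - real n))"
  have "r > 0" using \<open>C > 0\<close> by (simp add: r_def)
  define d where "d = (\<lambda>j. if j = 0 then 0 else c (j + m))"
  have le: "cmod (d j) \<le> cmod (complex_of_real r * exp_seq \<beta> j)" for j
  proof (cases "j = 0")
    case False
    then have "\<bar>real (j + m) - real n\<bar> = real j + (real m - real n)"
      using n by simp
    then have "cmod (d j) \<le> C * exp (- \<beta> * (real j + (real m - real n)))"
      using False decay[rule_format, of "j + m"] by (simp add: d_def)
    also have "\<dots> = r * exp (- \<beta> * real j)"
      by (simp add: r_def algebra_simps flip: exp_add)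
    finally show ?thesis
      using False \<open>r > 0\<close> by (simp add: exp_seq_def norm_mult)
  qed (simp add: d_def)
  have "d \<in> Xd \<and> nrm d \<le> nrm (\<lambda>j. complex_of_real r * exp_seq \<beta> j)"
    using solid[unfolded solid_def, rule_format, OF scale_mem[OF exp_mem] le] .
  then have d: "d \<in> Xd" "nrm d \<le> r * nrm (exp_seq \<beta>)"
    using nrm_scale[OF exp_mem, of "complex_of_real r"] \<open>r > 0\<close> by simp_all
  have "norm ((L ^^ m) x) \<le> B * nrm d"
    using expansion_left_shift_funpow[OF L x] norm_expansion_le[OF solid fin \<open>B > 0\<close> d(1)]
    by (simp add: d_def)
  also have "\<dots> \<le> B * (r * nrm (exp_seq \<beta>))"
    using d(2) \<open>B > 0\<close> by simp
  finally show ?thesis by (simp add: r_def mult.assoc)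
qed

end

section \<open>Convergence of the series and the error estimate\<close>

theorem theorem2p2:
  fixes e f :: "nat \<Rightarrow> 'a::complex_banach"
    and Xd :: "(nat \<Rightarrow> complex) set"
    and nrm :: "(nat \<Rightarrow> complex) \<Rightarrow> real"
    and L R T S :: "'a \<Rightarrow> 'a"
    and lam B C \<beta> :: real
    and \<epsilon> :: "nat \<Rightarrow> real"
    and \<alpha> :: "nat \<Rightarrow> nat"
    and \<phi> :: 'a
  assumes "separable_space (euclidean :: 'a topology)"
    and "schauder_basis e"
    and "banach_sequence_space Xd nrm"
    and "solid Xd nrm"
    and "absolutely_continuous_norm Xd nrm"
    and "\<forall>k\<ge>1. unit_seq k \<in> Xd"
    and "left_shift e L" and "right_shift e R"
    and "lam > onorm R"
    and T: "T = (\<lambda>x. lam *\<^sub>R L x)"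
    and S: "S = (\<lambda>x. inverse lam *\<^sub>R R x)"
    and "B > 0"
    and "\<forall>c. finite_seq c \<longrightarrow> norm (\<Sum>k | c k \<noteq> 0. c k *\<^sub>C e k) \<le> B * nrm c"
    and "C > 0"
    and "\<beta> > ln lam"
    and "exp_seq \<beta> \<in> Xd"
    and "\<forall>j\<ge>1. \<forall>k\<ge>1. cmod (dual_basis e j (f k)) \<le> C * exp (- \<beta> * \<bar>real j - real k\<bar>)"
    and "\<forall>k\<ge>1. \<epsilon> k > 0"
    and "summable (\<lambda>k. \<epsilon> (Suc k))"
    and "strict_mono_on {1..} \<alpha>"
    and "\<forall>k\<ge>2. onorm S ^ (\<alpha> k - \<alpha> (k - 1)) * norm (f k) \<le> \<epsilon> k / 2"
    and \<phi>: "\<phi> = (\<Sum>k. (S ^^ \<alpha> (Suc k)) (f (Suc k)))"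
  shows "summable (\<lambda>k. (S ^^ \<alpha> (Suc k)) (f (Suc k))) \<and>
    (\<alpha> 1 = 0 \<and>
     (\<forall>k\<ge>2. \<alpha> k \<ge> \<alpha> (k - 1) + (k - 2)) \<and>
     (\<forall>k\<ge>2. real (\<alpha> k) >
        (ln (\<Sum>j. \<epsilon> (k + 1 + j)) - ln (nrm (exp_seq \<beta>))
          - ln (\<Sum>n=1..k-1. (lam * exp (- \<beta>)) powi (- int (\<alpha> n)) * exp (\<beta> * real n))
          - ln (2 * B * C))
        / (ln lam - \<beta>)) \<longrightarrow>
     (\<forall>k\<ge>1. norm (f k - (T ^^ \<alpha> k) \<phi>) \<le> (\<Sum>n. \<epsilon> (k + 1 + n))))"
proof -
  interpret banach_sequence_space Xd nrm by fact
  note L = \<open>left_shift e L\<close> and R = \<open>right_shift e R\<close>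
  have blL: "bounded_linear L" and blR: "bounded_linear R"
    using L R by (simp_all add: left_shift_def right_shift_def bounded_clinear_linear)
  have lam: "lam > 0"
    using onorm_pos_le[OF blR] \<open>lam > onorm R\<close> by linarith
  have blS: "bounded_linear S" and blT: "bounded_linear T"
    unfolding S T using blL blR by (simp_all add: bounded_linear_const_scaleR)
  have "onorm S = inverse lam * onorm R"
    unfolding S using onorm_scaleR[OF blR] lam by simp
  also have "\<dots> \<le> 1"
    using lam \<open>lam > onorm R\<close> by (simp add: field_simps)
  finally have S_le1: "onorm S \<le> 1" .
  have S_ge0: "0 \<le> onorm S" using onorm_pos_le[OF blS] .
  have TS: "T (S x) = x" for x
    using left_shift_right_shift[OF \<open>schauder_basis e\<close> L R, of x] lam
    by (simp add: S T linear_cmul bounded_linear.linear[OF blL])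
  have \<alpha>_mono: "\<alpha> a \<le> \<alpha> b" if "1 \<le> a" "a \<le> b" for a b
    using that \<open>strict_mono_on {1..} \<alpha>\<close> by (auto simp: strict_mono_on_leD)
  \<comment> \<open>Removing \<open>d\<close> powers of \<open>S\<close> still leaves at least
    \<open>\<alpha> n - \<alpha> (n - 1)\<close> of them, and surplus powers do no harm as
    \<open>onorm S \<le> 1\<close>. The case \<open>d = 0\<close> yields convergence of the series,
    \<open>d = \<alpha> k\<close> the tail of the error.\<close>
  have S_bound: "norm ((S ^^ (\<alpha> n - d)) (f n)) \<le> \<epsilon> n / 2" if "n \<ge> 2" "d \<le> \<alpha> (n - 1)" for n d
  proof -
    have "norm ((S ^^ (\<alpha> n - d)) (f n)) \<le> onorm S ^ (\<alpha> n - d) * norm (f n)"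
      by (rule norm_funpow_le[OF blS])
    also have "\<dots> \<le> onorm S ^ (\<alpha> n - \<alpha> (n - 1)) * norm (f n)"
      using that S_ge0 S_le1 by (intro mult_right_mono power_decreasing) auto
    also have "\<dots> \<le> \<epsilon> n / 2"
      using that assms(21) by blast
    finally show ?thesis .
  qed
  have sum\<epsilon>: "summable (\<lambda>j. \<epsilon> (k + 1 + j))" for k
    using summable_ignore_initial_segment[OF \<open>summable (\<lambda>k. \<epsilon> (Suc k))\<close>, of k]
    by (simp add: add.commute)
  define g where "g = (\<lambda>k. (S ^^ \<alpha> (Suc k)) (f (Suc k)))"
  have sumg: "summable g"
  proof -
    \<comment> \<open>\<open>g n\<close> belongs to \<open>f (n + 1)\<close>. The term of
      \<open>f 1\<close> is left out, because the bound on the norms starts at index 2.\<close>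
    have "norm (g (Suc n)) \<le> \<epsilon> (1 + 1 + n) / 2" for n
      using S_bound[of "n + 2" 0] by (simp add: g_def)
    then have "summable (\<lambda>n. g (Suc n))"
      by (rule summable_comparison_test'[OF summable_divide[OF sum\<epsilon>[of 1], of 2]])
    then show ?thesis by (simp only: summable_Suc_iff)
  qed
  have "norm (f k - (T ^^ \<alpha> k) \<phi>) \<le> (\<Sum>n. \<epsilon> (k + 1 + n))"
    if gap: "\<forall>k\<ge>2. \<alpha> k \<ge> \<alpha> (k - 1) + (k - 2)"
      and large: "\<forall>k\<ge>2. real (\<alpha> k) >
        (ln (\<Sum>j. \<epsilon> (k + 1 + j)) - ln (nrm (exp_seq \<beta>))
          - ln (\<Sum>n=1..k-1. (lam * exp (- \<beta>)) powi (- int (\<alpha> n)) * exp (\<beta> * real n))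
          - ln (2 * B * C))
        / (ln lam - \<beta>)"
      and "k \<ge> 1" for k
  proof -
    obtain k0 where k: "k = Suc k0" using \<open>k \<ge> 1\<close> by (cases k) auto
    define E where "E = (\<Sum>j. \<epsilon> (k + 1 + j))"
    define N where "N = nrm (exp_seq \<beta>)"
    \<comment> \<open>\<open>q\<close> weighs the growth \<open>lam\<close> of one application of
      \<open>T\<close> against the decay gained by one left shift; \<open>\<beta> > ln lam\<close>
      makes \<open>ln q\<close> negative.\<close>
    define q where "q = lam * exp (- \<beta>)"
    define h where "h = (\<lambda>n. (T ^^ \<alpha> k) (g n))"
    have "E > 0" unfolding E_def
      using assms(18) by (intro suminf_pos[OF sum\<epsilon>]) simp
    have "q > 0" using lam by (simp add: q_def)
    have "exp_seq \<beta> 1 \<noteq> 0" by (simp add: exp_seq_def)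
    then have "N > 0"
      using nrm_nonneg[OF \<open>exp_seq \<beta> \<in> Xd\<close>] nrm_eq_0_iff[OF \<open>exp_seq \<beta> \<in> Xd\<close>]
      by (force simp: N_def)
    have h: "h sums (T ^^ \<alpha> k) \<phi>"
      unfolding h_def \<phi> using bounded_linear.sums[OF bounded_linear_funpow[OF blT] summable_sums[OF sumg]]
      by (simp add: g_def)
    \<comment> \<open>The term with index \<open>k0 = k - 1\<close> is
      \<open>(S ^^ \<alpha> k) (f k)\<close>, which \<open>T ^^ \<alpha> k\<close> turns back into
      \<open>f k\<close>.\<close>
    then have \<phi>_split: "(T ^^ \<alpha> k) \<phi> = (\<Sum>n<k0. h n) + f k + (\<Sum>n. h (n + k))"
      using suminf_split_initial_segment[OF sums_summable[OF h], of k] sums_unique[OF h]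
        funpow_left_inverse[of T S, OF TS]
      by (simp add: k h_def g_def)
    \<comment> \<open>Here \<open>h (n + k)\<close> comes from \<open>f (k + 1 + n)\<close>, whose
      predecessor index is at least \<open>k\<close>. So \<open>S_bound\<close> applies with
      \<open>d = \<alpha> k\<close>.\<close>
    have tail: "norm (\<Sum>n. h (n + k)) \<le> E / 2"
    proof -
      have "norm (h (n + k)) \<le> \<epsilon> (k + 1 + n) / 2" for n
      proof -
        have "h (n + k) = (S ^^ (\<alpha> (k + 1 + n) - \<alpha> k)) (f (k + 1 + n))"
          unfolding h_def g_def using \<open>k \<ge> 1\<close>
          by (subst funpow_left_inverse_ge[of T S, OF TS]) (auto intro: \<alpha>_mono simp: add_ac)
        then show ?thesis
          using S_bound[of "k + 1 + n" "\<alpha> k"] \<open>k \<ge> 1\<close> \<alpha>_mono[of k "k + n"] by simp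
      qed
      then have "norm (\<Sum>n. h (n + k)) \<le> (\<Sum>n. \<epsilon> (k + 1 + n) / 2)"
        by (intro norm_suminf_le summable_divide sum\<epsilon>)
      then show ?thesis by (simp only: E_def suminf_divide[OF sum\<epsilon>])
    qed
    \<comment> \<open>For \<open>k = 1\<close> the sum is empty; the lower bound on
      \<open>\<alpha> k\<close> is available from \<open>k = 2\<close> on.\<close>
    have head: "norm (\<Sum>n<k0. h n) \<le> E / 2"
    proof (cases "k0 = 0")
      case False
      define Q where "Q = (\<Sum>n=1..k-1. q powi (- int (\<alpha> n)) * exp (\<beta> * real n))"
      have "Q > 0" unfolding Q_def
        using False k \<open>q > 0\<close> by (intro sum_pos) auto
      have "norm (h n) \<le> B * C * N * q ^ \<alpha> k * (q powi (- int (\<alpha> (Suc n))) * exp (\<beta> * real (Suc n)))"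
        if "n < k0" for n
      proof -
        define m where "m = \<alpha> k - \<alpha> (Suc n)"
        have le: "\<alpha> (Suc n) \<le> \<alpha> k" using that k by (intro \<alpha>_mono) auto
        \<comment> \<open>The gap condition at index \<open>n + 2\<close> contributes exactly
          \<open>n\<close>, hence \<open>m \<ge> n\<close>: enough shifts to pass the peak of the
          coefficients of \<open>f (n + 1)\<close>.\<close>
        have "\<alpha> (Suc n) + n \<le> \<alpha> (Suc (Suc n))"
          using gap[rule_format, of "Suc (Suc n)"] by simp
        also have "\<dots> \<le> \<alpha> k" using that k by (intro \<alpha>_mono) auto
        finally have "Suc n \<le> m + 1" by (simp add: m_def)
        have "h n = lam ^ m *\<^sub>R (L ^^ m) (f (Suc n))"
          unfolding h_def g_def funpow_left_inverse_le[of T S, OF TS le]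
          by (simp add: T funpow_scaleR[OF blL] m_def)
        moreover have "norm ((L ^^ m) (f (Suc n)))
            \<le> B * C * exp (- \<beta> * (real m - real (Suc n))) * N"
          unfolding N_def
          by (rule norm_left_shift_funpow_le[OF \<open>solid Xd nrm\<close> assms(13) \<open>B > 0\<close> \<open>C > 0\<close>
                \<open>exp_seq \<beta> \<in> Xd\<close> L expansion_dual_basis[OF \<open>schauder_basis e\<close>] _ \<open>Suc n \<le> m + 1\<close>])
            (use assms(17)[rule_format, of _ "Suc n"] in auto)
        ultimately have "norm (h n) \<le> lam ^ m * (B * C * exp (- \<beta> * (real m - real (Suc n))) * N)"
          using lam by simp
        also have "exp (- \<beta> * (real m - real (Suc n))) = exp (- \<beta>) ^ m * exp (\<beta> * real (Suc n))"
          by (simp add: algebra_simps flip: exp_of_nat_mult exp_add)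
        also have "lam ^ m * (B * C * (exp (- \<beta>) ^ m * exp (\<beta> * real (Suc n))) * N)
            = B * C * N * q ^ m * exp (\<beta> * real (Suc n))"
          by (simp add: q_def power_mult_distrib)
        \<comment> \<open>Pulling out \<open>q ^ \<alpha> k\<close>, which does not depend on
          \<open>n\<close>, leaves the summand of \<open>Q\<close>.\<close>
        also have "q ^ m = q ^ \<alpha> k * q powi (- int (\<alpha> (Suc n)))"
          using le \<open>q > 0\<close> by (simp add: m_def power_diff power_int_minus divide_inverse)
        finally show ?thesis by (simp add: mult.assoc)
      qed
      then have "norm (\<Sum>n<k0. h n)
          \<le> (\<Sum>n<k0. B * C * N * q ^ \<alpha> k * (q powi (- int (\<alpha> (Suc n))) * exp (\<beta> * real (Suc n))))"
        by (intro sum_norm_le) simp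
      also have "\<dots> = B * C * N * q ^ \<alpha> k * Q"
        unfolding Q_def sum_distrib_left k
        by (rule sum.reindex_bij_witness[of _ "\<lambda>n. n - 1" Suc]) auto
      also have "\<dots> \<le> E / 2"
      proof -
        have "real (\<alpha> k) > (ln E - ln N - ln Q - ln (2 * B * C)) / (ln lam - \<beta>)"
          using large[rule_format, of k] False k by (simp add: E_def N_def Q_def q_def)
        \<comment> \<open>The denominator is negative, so clearing it reverses the inequality. What
          results is the logarithm of \<open>2 * B * C * N * q ^ \<alpha> k * Q < E\<close>.\<close>
        then have "real (\<alpha> k) * (ln lam - \<beta>) < ln E - ln N - ln Q - ln (2 * B * C)"
          using \<open>\<beta> > ln lam\<close> by (simp add: divide_less_eq)
        moreover have "ln q = ln lam - \<beta>"
          using lam by (simp add: q_def ln_mult)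
        moreover have "ln (2 * B * C * N * q ^ \<alpha> k * Q) = ln (2 * B * C) + ln N + real (\<alpha> k) * ln q + ln Q"
          using \<open>B > 0\<close> \<open>C > 0\<close> \<open>N > 0\<close> \<open>q > 0\<close> \<open>Q > 0\<close> by (simp add: ln_mult ln_realpow)
        ultimately have "ln (2 * B * C * N * q ^ \<alpha> k * Q) < ln E" by simp
        then have "2 * B * C * N * q ^ \<alpha> k * Q < E"
          using \<open>B > 0\<close> \<open>C > 0\<close> \<open>N > 0\<close> \<open>q > 0\<close> \<open>Q > 0\<close> \<open>E > 0\<close> by (subst (asm) ln_less_cancel_iff) auto
        then show ?thesis by simp
      qed
      finally show ?thesis .
    qed (use \<open>E > 0\<close> in simp)
    have "norm (f k - (T ^^ \<alpha> k) \<phi>) = norm ((\<Sum>n<k0. h n) + (\<Sum>n. h (n + k)))"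
      by (subst norm_minus_commute) (simp add: \<phi>_split)
    also have "\<dots> \<le> E / 2 + E / 2"
      using norm_triangle_mono[OF head tail] .
    finally show ?thesis by (simp add: E_def)
  qed
  then show ?thesis using sumg by (simp add: g_def)
qed

end
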